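(* Let $n,m,k \geq 0$, $w \in P(n,m)$ and $u \in P(m,k)$. Then $\mathbf{blno}^{w \otimes u, x} = \mathbf{blno}^{u,x} \circ \mathbf{blno}^{w,x}$ as maps from $\{0,1,\ldots,n\}$ to $\{0,1,\ldots,k\}$.
   Context: $P(n,m)$ denotes the set of words $w \in \{x,y\}^{*}$ with exactly $n$ occurrences of $x$ and $m$ occurrences of $y$. Blocks: the $m$ occurrences of $y$ split $w\in P(n,m)$ into $m+1$ (possibly empty) words $\mathbf{bl}^{w,x}_0,\ldots,\mathbf{bl}^{w,x}_m \in \{x\}^{*}$ with $w = \mathbf{bl}^{w,x}_0 \, y\, \mathbf{bl}^{w,x}_1\, y \cdots y\, \mathbf{bl}^{w,x}_m$; similarly the $n$ occurrences of $x$ split $w$ into words $\mathbf{bl}^{w,y}_0,\ldots,\mathbf{bl}^{w,y}_n \in \{y\}^{*}$ with $w = \mathbf{bl}^{w,y}_0\, x\, \mathbf{bl}^{w,y}_1\, x\cdots x\, \mathbf{bl}^{w,y}_n$. For $i \in \{1,\ldots,n\}$, $\mathbf{blno}^{w,x}_i \in \{0,\ldots,m\}$ is the index of the $x$-block containing the $i$-th occurrence of $x$ in $w$, i.e. the number of $y$'s preceding the $i$-th occurrence of $x$; by convention $\mathbf{blno}^{w,x}_0 = 0$. The map $\mathbf{blno}^{w,x} : \{0,\ldots,n\} \to \{0,\ldots,m\}$ sends $i$ to $\mathbf{blno}^{w,x}_i$. (The assignment $w \mapsto \mathbf{blno}^{w,x}$ is a bijection from $P(n,m)$ to the set of monotone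 maps $\{0,\ldots,n\} \to \{0,\ldots,m\}$ sending $0$ to $0$.) Product: for $w \in P(n,m)$ and $u \in P(m,k)$, $w \otimes u := \mathbf{bl}^{w,x}_0\, \mathbf{bl}^{u,y}_0\, \mathbf{bl}^{w,x}_1\, \mathbf{bl}^{u,y}_1 \cdots \mathbf{bl}^{w,x}_m\, \mathbf{bl}^{u,y}_m \in P(n,k)$. *)

theory Defs
  imports Main "HOL-Library.FuncSet"
begin

datatype letter = Lx | Ly

fun other :: "letter \<Rightarrow> letter" where
  "other Lx = Ly"
| "other Ly = Lx"

definition P :: "nat \<Rightarrow> nat \<Rightarrow> letter list set" where
  "P n m = {w. count_list w Lx = n \<and> count_list w Ly = m}"

text \<open>The list of \<open>a\<close>-blocks of a word, that is, of the maximal (possibly empty) words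
  between consecutive occurrences of the other letter. The lemma \<open>block_list_iff\<close> below says
  that this is the unique decomposition \<open>w = b\<^sub>0 c b\<^sub>1 c \<dots> c b\<^sub>r\<close> with
  \<open>c = other a\<close> and every \<open>b\<^sub>j\<close> a power of \<open>a\<close>.\<close>

fun block_list :: "letter list \<Rightarrow> letter \<Rightarrow> letter list list" where
  "block_list [] a = [[]]"
| "block_list (b # w) a =
    (if b = a then (b # hd (block_list w a)) # tl (block_list w a)
     else [] # block_list w a)"

definition bl :: "letter list \<Rightarrow> letter \<Rightarrow> nat \<Rightarrow> letter list" where
  "bl w a j = block_list w a ! j"

text \<open>The position in \<open>w\<close> (counted from 0) of the \<open>i\<close>-th occurrence of \<open>a\<close>
  (counted from 1); meaningful for \<open>1 \<le> i \<le> count_list w a\<close>.\<close>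

definition occ_pos :: "letter list \<Rightarrow> letter \<Rightarrow> nat \<Rightarrow> nat" where
  "occ_pos w a i = filter (\<lambda>p. w ! p = a) [0..<length w] ! (i - 1)"

text \<open>The block-number map has domain \<open>{0..n}\<close>, where \<open>n\<close> is the number of occurrences
  of \<open>a\<close>. It is extensional (\<open>undefined\<close> off its domain), so that HOL equality is equality
  of maps with this domain.\<close>

definition blno :: "letter list \<Rightarrow> letter \<Rightarrow> nat \<Rightarrow> nat" where
  "blno w a = (\<lambda>i\<in>{0..count_list w a}.
     if i = 0 then 0 else count_list (take (occ_pos w a i) w) (other a))"

definition word_prod :: "letter list \<Rightarrow> letter list \<Rightarrow> letter list"  (infixl \<open>\<otimes>\<close> 70) where
  "w \<otimes> u = concat (map (\<lambda>j. bl w Lx j @ bl u Ly j) [0..<Suc (count_list w Ly)])"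

lemma other_neq [simp]: "other a \<noteq> a" "a \<noteq> other a"
  by (cases a; simp)+

lemma neq_iff_other: "b \<noteq> a \<longleftrightarrow> b = other a"
  by (cases a; cases b; simp)

lemma block_list_nonempty [simp]: "block_list w a \<noteq> []"
  by (cases w) auto

lemma length_block_list: "length (block_list w a) = Suc (count_list w (other a))"
  by (induction w) (auto simp: neq_iff_other)

lemma set_block_list: "b \<in> set (block_list w a) \<Longrightarrow> set b \<subseteq> {a}"
proof (induction w arbitrary: b)
  case (Cons c w)
  then show ?case
    by (cases "block_list w a") (fastforce split: if_splits)+
qed auto

lemma block_list_decomp:
  "w = hd (block_list w a) @ concat (map (\<lambda>b. other a # b) (tl (block_list w a)))"
proof (induction w)
  case (Cons c w)
  show ?case
  proof (cases "c = a")
    case True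
    then show ?thesis using Cons by simp
  next
    case False
    have "concat (map (\<lambda>b. other a # b) (block_list w a)) = other a # w"
      using Cons.IH by (cases "block_list w a") auto
    then show ?thesis using False by (simp add: neq_iff_other)
  qed
qed auto

lemma block_list_block_append:
  "set b \<subseteq> {a} \<Longrightarrow>
   block_list (b @ v) a = (b @ hd (block_list v a)) # tl (block_list v a)"
  by (induction b) auto

lemma block_list_join:
  assumes "\<forall>b\<in>set (b0 # bs). set b \<subseteq> {a}"
  shows "block_list (b0 @ concat (map (\<lambda>b. other a # b) bs)) a = b0 # bs"
  using assms
proof (induction bs arbitrary: b0)
  case Nil
  then show ?case using block_list_block_append[of b0 a "[]"] by simp
next
  case (Cons b bs)
  then have "block_list (b @ concat (map (\<lambda>b. other a # b) bs)) a = b # bs"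
    by simp
  then show ?case using Cons.prems by (simp add: block_list_block_append)
qed

lemma block_list_iff:
  "block_list w a = bs \<longleftrightarrow>
     bs \<noteq> [] \<and> (\<forall>b\<in>set bs. set b \<subseteq> {a}) \<and>
     w = hd bs @ concat (map (\<lambda>b. other a # b) (tl bs))"
proof
  assume "block_list w a = bs"
  then show "bs \<noteq> [] \<and> (\<forall>b\<in>set bs. set b \<subseteq> {a}) \<and>
     w = hd bs @ concat (map (\<lambda>b. other a # b) (tl bs))"
    using set_block_list block_list_decomp block_list_nonempty by blast
next
  assume "bs \<noteq> [] \<and> (\<forall>b\<in>set bs. set b \<subseteq> {a}) \<and>
     w = hd bs @ concat (map (\<lambda>b. other a # b) (tl bs))"
  then show "block_list w a = bs"
    using block_list_join[of "hd bs" "tl bs" a] by simp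
qed

lemma count_list_concat: "count_list (concat ws) a = (\<Sum>w\<leftarrow>ws. count_list w a)"
  by (induction ws) auto

lemma sum_count_block_list: "(\<Sum>b\<leftarrow>block_list w a. count_list b a) = count_list w a"
proof (induction w)
  case (Cons c w)
  then show ?case by (cases "block_list w a") auto
qed auto

lemma sum_count_bl:
  assumes "k = Suc (count_list w (other a))"
  shows "(\<Sum>j\<leftarrow>[0..<k]. count_list (bl w a j) a) = count_list w a"
    and "(\<Sum>j\<leftarrow>[0..<k]. count_list (bl w a j) (other a)) = 0"
proof -
  have eq: "map (bl w a) [0..<k] = block_list w a"
    using assms by (auto simp: bl_def length_block_list intro!: nth_equalityI simp del: upt_Suc)
  have "(\<Sum>j\<leftarrow>[0..<k]. count_list (bl w a j) a) = (\<Sum>b\<leftarrow>map (bl w a) [0..<k]. count_list b a)"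
    by (simp add: o_def)
  then show "(\<Sum>j\<leftarrow>[0..<k]. count_list (bl w a j) a) = count_list w a"
    by (simp only: eq sum_count_block_list)
  have "count_list (bl w a j) (other a) = 0" if "j < k" for j
  proof -
    have "bl w a j \<in> set (block_list w a)"
      using that assms by (simp add: bl_def length_block_list)
    then show ?thesis using set_block_list other_neq(1) by (fastforce simp: count_list_0_iff)
  qed
  then show "(\<Sum>j\<leftarrow>[0..<k]. count_list (bl w a j) (other a)) = 0"
    by (auto simp del: upt_Suc)
qed

lemma word_prod_in_P:
  assumes "w \<in> P n m" and "u \<in> P m k"
  shows "w \<otimes> u \<in> P n k"
proof -
  have w: "count_list w Lx = n" "count_list w Ly = m"
    and u: "count_list u Lx = m" "count_list u Ly = k"
    using assms by (auto simp: P_def)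
  have "count_list (w \<otimes> u) a = (\<Sum>j\<leftarrow>[0..<Suc m]. count_list (bl w Lx j) a)
      + (\<Sum>j\<leftarrow>[0..<Suc m]. count_list (bl u Ly j) a)" for a
    by (simp add: word_prod_def count_list_concat o_def sum_list_addf w del: upt_Suc)
  then show ?thesis
    using sum_count_bl[of "Suc m" w Lx] sum_count_bl[of "Suc m" u Ly] w u
    by (simp add: P_def del: upt_Suc)
qed

lemma count_list_take_le: "count_list (take p w) a \<le> count_list w a"
  by (metis append_take_drop_id count_list_append le_add1)

lemma blno_in_funcset:
  assumes "w \<in> P n m"
  shows "blno w Lx \<in> {0..n} \<rightarrow>\<^sub>E {0..m}"
  using assms by (auto simp: blno_def P_def count_list_take_le)

end

theory Submission
  imports Defs
begin

text \<open>The list of block numbers of the occurrences of a letter, and the product of words,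
  both satisfy recursion equations along the words: a leading \<open>x\<close> of \<open>w\<close> and, when \<open>w\<close> does
  not start with \<open>x\<close>, a leading \<open>y\<close> of \<open>u\<close> is emitted into \<open>w \<otimes> u\<close>, whereas a leading \<open>y\<close>
  of \<open>w\<close> cancels against a leading \<open>x\<close> of \<open>u\<close>. The claim follows by induction along these
  equations.\<close>

fun block_numbers :: "letter list \<Rightarrow> letter \<Rightarrow> nat list" where
  "block_numbers [] a = []"
| "block_numbers (b # w) a =
    (if b = a then 0 # block_numbers w a else map Suc (block_numbers w a))"

lemma length_block_numbers [simp]: "length (block_numbers w a) = count_list w a"
  by (induction w) auto

lemma block_numbers_le:
  "i \<in> set (block_numbers w a) \<Longrightarrow> i \<le> count_list w (other a)"
  by (induction w arbitrary: i) (fastforce simp: neq_iff_other split: if_splits)+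

text \<open>The positions of \<open>b # w\<close> are 0 and the successors of those of
  \<open>w\<close>; a leading \<open>other a\<close> raises each later prefix count by one.\<close>

lemma block_numbers_conv_filter:
  "block_numbers w a =
     map (\<lambda>p. count_list (take p w) (other a)) (filter (\<lambda>p. w ! p = a) [0..<length w])"
proof (induction w)
  case (Cons b w)
  have "[0..<length (b # w)] = 0 # map Suc [0..<length w]"
    by (simp add: map_Suc_upt upt_conv_Cons del: upt_Suc)
  then show ?case
    using Cons by (simp add: filter_map o_def neq_iff_other del: upt_Suc)
qed simp

text \<open>The prepended 0 encodes the convention at index 0 and aligns occurrences, counted from
  1, with list positions, counted from 0.\<close>

lemma blno_conv_block_numbers:
  assumes "i \<le> count_list w a"
  shows "blno w a i = (0 # block_numbers w a) ! i"
proof (cases i)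
  case (Suc j)
  have "length (filter (\<lambda>p. w ! p = a) [0..<length w]) = count_list w a"
    using arg_cong[OF block_numbers_conv_filter, of length w a] by simp
  then show ?thesis
    using assms Suc by (simp add: blno_def occ_pos_def block_numbers_conv_filter)
qed (simp add: blno_def)

text \<open>Both block lists have the same length, so zipping cuts nothing off.\<close>

lemma word_prod_conv_zip:
  assumes "count_list w Ly = count_list u Lx"
  shows "w \<otimes> u = concat (map2 (@) (block_list w Lx) (block_list u Ly))"
proof -
  have "map (\<lambda>j. bl w Lx j @ bl u Ly j) [0..<Suc (count_list w Ly)] =
      map2 (@) (block_list w Lx) (block_list u Ly)"
    using assms
    by (auto simp: bl_def length_block_list intro!: nth_equalityI simp del: upt_Suc)
  then show ?thesis
    by (simp add: word_prod_def del: upt_Suc)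
qed

lemma word_prod_Nil:
  assumes "count_list u Lx = 0"
  shows "[] \<otimes> u = u"
proof -
  have "set u \<subseteq> {Ly}"
    using assms neq_iff_other[of _ Lx] by (auto simp: count_list_0_iff)
  then have "block_list u Ly = [u]"
    using block_list_block_append[of u Ly "[]"] by simp
  then show ?thesis
    using assms by (simp add: word_prod_conv_zip)
qed

lemma word_prod_Lx:
  "count_list w Ly = count_list u Lx \<Longrightarrow> (Lx # w) \<otimes> u = Lx # (w \<otimes> u)"
  by (cases "block_list w Lx"; cases "block_list u Ly") (auto simp: word_prod_conv_zip)

text \<open>Both block lists start with an empty block, and this first pair contributes
  nothing.\<close>

lemma word_prod_Ly_Lx:
  "count_list w Ly = count_list u Lx \<Longrightarrow> (Ly # w) \<otimes> (Lx # u) = w \<otimes> u"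
  by (simp add: word_prod_conv_zip)

lemma word_prod_Ly_Ly:
  "Suc (count_list w Ly) = count_list u Lx \<Longrightarrow>
   (Ly # w) \<otimes> (Ly # u) = Ly # ((Ly # w) \<otimes> u)"
  by (cases "block_list u Ly") (auto simp: word_prod_conv_zip)

lemma block_numbers_word_prod:
  assumes "count_list w Ly = count_list u Lx"
  shows "block_numbers (w \<otimes> u) Lx =
    map ((!) (0 # block_numbers u Lx)) (block_numbers w Lx)"
  using assms
\<comment> \<open>The measure is the sum because a case may shorten only \<open>w\<close>, only
  \<open>u\<close>, or both.\<close>
proof (induction "length w + length u" arbitrary: w u rule: less_induct)
  case less
  show ?case
  proof (cases w)
    case Nil
    then have "count_list u Lx = 0"
      using less.prems by simp
    moreover from this have "block_numbers u Lx = []"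
      by (metis length_0_conv length_block_numbers)
    ultimately show ?thesis
      using Nil by (simp add: word_prod_Nil)
  next
    case (Cons b w')
    show ?thesis
    proof (cases b)
      case Lx
      then show ?thesis using less Cons by (simp add: word_prod_Lx)
    next
      case Ly
      then obtain c u' where u: "u = c # u'"
        using less.prems Cons by (cases u) auto
      show ?thesis
      proof (cases c)
        case Lx
        \<comment> \<open>The \<open>x\<close> removed from \<open>u\<close> shifts the lookup list
          by one, the \<open>y\<close> removed from \<open>w\<close> shifts the indices by
          one.\<close>
        then show ?thesis
          using less Cons \<open>b = Ly\<close> u by (simp add: word_prod_Ly_Lx)
      next
        case c: Ly
        have count: "Suc (count_list w' Ly) = count_list u' Lx"
          using less.prems Cons \<open>b = Ly\<close> u c by simp
        \<comment> \<open>This bound lets the lookup commute with the \<open>map Suc\<close> caused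
          by the leading \<open>y\<close> of \<open>u\<close>; the leading \<open>y\<close> of
          \<open>w\<close> makes all indices positive, so the prepended 0 is never read.\<close>
        then have "\<forall>i\<in>set (block_numbers w' Lx). i < count_list u' Lx"
          using block_numbers_le[of _ w' Lx] by fastforce
        moreover have "block_numbers (w \<otimes> u') Lx =
            map ((!) (0 # block_numbers u' Lx)) (block_numbers w Lx)"
          using less.hyps[of w u'] count Cons \<open>b = Ly\<close> u by simp
        ultimately show ?thesis
          using count Cons \<open>b = Ly\<close> u c by (simp add: word_prod_Ly_Ly)
      qed
    qed
  qed
qed

theorem proposition1:
  fixes n m k :: nat and w u :: "letter list"
  assumes "w \<in> P n m" and "u \<in> P m k"
  shows "blno (w \<otimes> u) Lx = compose {0..n} (blno u Lx) (blno w Lx)"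
proof
  fix i
  have w: "count_list w Lx = n" "count_list w Ly = m"
    and u: "count_list u Lx = m"
    and wu: "count_list (w \<otimes> u) Lx = n"
    using assms word_prod_in_P[OF assms] by (auto simp: P_def)
  show "blno (w \<otimes> u) Lx i = compose {0..n} (blno u Lx) (blno w Lx) i"
  proof (cases "i \<le> n")
    case True
    then have "blno w Lx i \<le> m"
      using blno_in_funcset[OF assms(1)] by (auto simp: PiE_iff)
    then have "blno u Lx (blno w Lx i) =
        (0 # block_numbers u Lx) ! ((0 # block_numbers w Lx) ! i)"
      using True w u by (simp add: blno_conv_block_numbers)
    also have "\<dots> = (0 # block_numbers (w \<otimes> u) Lx) ! i"
      using True w u by (cases i) (simp_all add: block_numbers_word_prod)
    also have "\<dots> = blno (w \<otimes> u) Lx i"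
      using True wu by (simp add: blno_conv_block_numbers)
    finally show ?thesis
      using True by (simp add: compose_def)
  next
    case False
    \<comment> \<open>Off the domain both sides are \<open>undefined\<close> by
      extensionality.\<close>
    then show ?thesis
      using wu by (simp add: blno_def compose_def)
  qed
qed

end
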